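(* Let $\lambda_0\ge 1$ be an integer and consider the family of restart strategies $\lambda_k=\lceil\lambda_0\rho^k\rceil$, $k\ge 0$, with restart parameter $\rho\in\mathbb{R}$, $\rho>1$. This strategy type is asymptotically optimal with optimal choice $\hat\rho=2$ of the restart parameter, with respect to the asymptotic upper bound $\overline{\ell}^{\times}_{\mathrm{up}}(\rho)=\lim_{\hat\lambda\to\infty}\ell^\times_{\mathrm{up}}(\hat\lambda,\rho)=\rho+\frac{1}{\rho-1}$ of the relative loss function. Furthermore, $\overline{\ell}^{\times}_{\mathrm{up}}(\hat\rho)=3$.
   Context: For an integer $\hat\lambda\ge\lambda_0$ let $\hat k(\hat\lambda)=\min\{k\ge 0 : \lambda_k\ge\hat\lambda\}$. The loss function of the strategy $\lambda_k=\lceil\lambda_0\rho^k\rceil$ is $\mathcal{L}^\times(\hat\lambda,\rho)=\sum_{k=0}^{\hat k(\hat\lambda)}\lambda_k-\hat\lambda$, and the relative loss function is $\ell^\times(\hat\lambda,\rho)=\mathcal{L}^\times(\hat\lambda,\rho)/\hat\lambda$. If $\ell_{\mathrm{up}}(\hat\lambda,\rho)$ is an upper bound of the relative loss function (for all integers $\hat\lambda\ge\lambda_0$), then $\overline{\ell}_{\mathrm{up}}(\rho)=\lim_{\hat\lambda\to\infty}\ell_{\mathrm{up}}(\hat\lambda,\rho)$ is called the asymptotic upper bound. Here the upper bound used is $$\ell^\times_{\mathrm{up}}(\hat\lambda,\rho)=\rho+\frac{1}{\rho-1}-\frac{\lambda_0}{\hat\lambda(\rho-1)}+\frac{\ln(\hat\lambda/\lambda_0)}{\hat\lambda\ln(\rho)}.$$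 A strategy is bounded if a finite asymptotic upper bound exists for the given restart parameter. A bounded strategy type is called asymptotically optimal if there exists a restart parameter for which the asymptotic upper bound is minimal (among all admissible restart parameters, here all $\rho>1$); this value, independent of $\hat\lambda$, is called the optimal choice of the restart parameter and is denoted $\hat\rho$. *)

theory Defs
  imports "HOL-Analysis.Analysis"
begin

text \<open>
  A restart strategy is a sequence \<open>lam :: nat \<Rightarrow> int\<close> of restart lengths; a strategy type is a
  family \<open>S :: real \<Rightarrow> nat \<Rightarrow> int\<close> of strategies indexed by the restart parameter.
\<close>

definition geometric_strategy :: "int \<Rightarrow> real \<Rightarrow> nat \<Rightarrow> int" where
  "geometric_strategy lam0 \<rho> k = \<lceil>of_int lam0 * \<rho> ^ k\<rceil>"

text \<open>The value of \<open>LEAST\<close> is meaningful only if some restart length reaches \<open>h\<close>, which is the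
  case for every \<open>h\<close> when the sequence is unbounded.\<close>

definition khat :: "(nat \<Rightarrow> int) \<Rightarrow> int \<Rightarrow> nat" where
  "khat lam h = (LEAST k. lam k \<ge> h)"

definition loss :: "(nat \<Rightarrow> int) \<Rightarrow> int \<Rightarrow> int" where
  "loss lam h = (\<Sum>k=0..khat lam h. lam k) - h"

definition rel_loss :: "(nat \<Rightarrow> int) \<Rightarrow> int \<Rightarrow> real" where
  "rel_loss lam h = of_int (loss lam h) / of_int h"

definition rel_loss_upper_bound :: "(nat \<Rightarrow> int) \<Rightarrow> (int \<Rightarrow> real) \<Rightarrow> bool" where
  "rel_loss_upper_bound lam u \<longleftrightarrow> (\<forall>h \<ge> lam 0. rel_loss lam h \<le> u h)"

text \<open>\<open>L\<close> is a real number, so the limit is finite; it is unique, since \<open>at_top\<close> is a nontrivial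
  filter on the integers.\<close>

definition asymptotic_upper_bound :: "(nat \<Rightarrow> int) \<Rightarrow> (int \<Rightarrow> real) \<Rightarrow> real \<Rightarrow> bool" where
  "asymptotic_upper_bound lam u L \<longleftrightarrow> rel_loss_upper_bound lam u \<and> (u \<longlongrightarrow> L) at_top"

definition bounded_strategy :: "(nat \<Rightarrow> int) \<Rightarrow> (int \<Rightarrow> real) \<Rightarrow> bool" where
  "bounded_strategy lam u \<longleftrightarrow> (\<exists>L. asymptotic_upper_bound lam u L)"

text \<open>Below, \<open>P\<close> is the set of admissible restart parameters, and \<open>u \<rho>\<close> is the upper bound used for
  the strategy \<open>S \<rho>\<close>.\<close>

definition optimal_choice ::
    "real set \<Rightarrow> (real \<Rightarrow> nat \<Rightarrow> int) \<Rightarrow> (real \<Rightarrow> int \<Rightarrow> real) \<Rightarrow> real \<Rightarrow> bool" where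
  "optimal_choice P S u r \<longleftrightarrow> r \<in> P \<and>
     (\<exists>L. asymptotic_upper_bound (S r) (u r) L \<and>
          (\<forall>\<rho>\<in>P. \<forall>M. asymptotic_upper_bound (S \<rho>) (u \<rho>) M \<longrightarrow> L \<le> M))"

definition asymptotically_optimal ::
    "real set \<Rightarrow> (real \<Rightarrow> nat \<Rightarrow> int) \<Rightarrow> (real \<Rightarrow> int \<Rightarrow> real) \<Rightarrow> bool" where
  "asymptotically_optimal P S u \<longleftrightarrow>
     (\<forall>\<rho>\<in>P. bounded_strategy (S \<rho>) (u \<rho>)) \<and> (\<exists>r. optimal_choice P S u r)"

definition geometric_upper :: "int \<Rightarrow> real \<Rightarrow> int \<Rightarrow> real" where
  "geometric_upper lam0 \<rho> h =
     \<rho> + 1 / (\<rho> - 1) - of_int lam0 / (of_int h * (\<rho> - 1))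
       + ln (of_int h / of_int lam0) / (of_int h * ln \<rho>)"

end

theory Submission
  imports Defs "HOL-Real_Asymp.Real_Asymp"
begin

text \<open>
  If \<open>K = khat lam h\<close> is positive, minimality gives \<open>lam0 * \<rho> ^ (K - 1) \<le> h - 1\<close>. Hence the geometric
  part of the sum is at most \<open>(\<rho>\<^sup>2 * (h - 1) - lam0) / (\<rho> - 1)\<close>, and \<open>K - 1\<close> is at most the
  logarithm of \<open>h / lam0\<close> to base \<open>\<rho>\<close>. Rounding contributes at most \<open>K\<close>, because the term at index 0
  is already an integer. The excess \<open>1\<close> in \<open>K\<close> is absorbed by \<open>\<rho>\<^sup>2 / (\<rho> - 1) \<ge> 4\<close>.
  The limit \<open>\<rho> + 1 / (\<rho> - 1)\<close> exceeds \<open>3\<close> by \<open>(\<rho> - 2)\<^sup>2 / (\<rho> - 1)\<close>.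
\<close>

lemma sum_geometric_strategy_le:
  fixes \<rho> :: real
  assumes "\<rho> \<noteq> 1"
  shows "real_of_int (\<Sum>k=0..n. geometric_strategy lam0 \<rho> k)
    \<le> of_int lam0 * (\<rho> ^ Suc n - 1) / (\<rho> - 1) + real n"
proof (induction n)
  case 0
  then show ?case using assms by (simp add: geometric_strategy_def)
next
  case (Suc n)
  have "real_of_int (geometric_strategy lam0 \<rho> (Suc n)) \<le> of_int lam0 * \<rho> ^ Suc n + 1"
    unfolding geometric_strategy_def by linarith
  moreover have "of_int lam0 * (\<rho> ^ Suc (Suc n) - 1) / (\<rho> - 1)
      = of_int lam0 * (\<rho> ^ Suc n - 1) / (\<rho> - 1) + of_int lam0 * \<rho> ^ Suc n"
    using assms by (simp add: field_simps)
  ultimately show ?case using Suc by simp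
qed

text \<open>A ceiling below the integer \<open>h\<close> is at most \<open>h - 1\<close>, and it
  dominates its argument. The unit gained here by integrality is what later compensates for
  rounding.\<close>

lemma geometric_strategy_less_khat:
  assumes "k < khat (geometric_strategy lam0 \<rho>) h"
  shows "of_int lam0 * \<rho> ^ k \<le> real_of_int h - 1"
proof -
  have "geometric_strategy lam0 \<rho> k < h"
    using not_less_Least[OF assms[unfolded khat_def]] by simp
  then show ?thesis unfolding geometric_strategy_def by linarith
qed

text \<open>The right-hand side is \<open>geometric_upper lam0 \<rho> h\<close> multiplied by
  \<open>h\<close>, so the estimate runs without denominators in \<open>h\<close>.\<close>

lemma loss_geometric_strategy_le:
  fixes \<rho> :: real
  assumes "lam0 \<ge> 1" "\<rho> > 1" "h \<ge> lam0"
  shows "real_of_int (loss (geometric_strategy lam0 \<rho>) h)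
    \<le> (\<rho> + 1 / (\<rho> - 1)) * of_int h - of_int lam0 / (\<rho> - 1)
      + ln (of_int h / of_int lam0) / ln \<rho>"
proof (cases "khat (geometric_strategy lam0 \<rho>) h")
  case 0
  \<comment> \<open>Here the loss is \<open>lam0 - h\<close>, hence at most 0. Regrouping the bound
    around \<open>h - lam0\<close> makes each of its summands visibly nonnegative.\<close>
  have "0 \<le> \<rho> * of_int h + (of_int h - of_int lam0) / (\<rho> - 1)
      + ln (of_int h / of_int lam0) / ln \<rho>"
    using assms by (intro add_nonneg_nonneg) auto
  also have "\<dots> = (\<rho> + 1 / (\<rho> - 1)) * of_int h - of_int lam0 / (\<rho> - 1)
      + ln (of_int h / of_int lam0) / ln \<rho>"
    by (simp add: algebra_simps diff_divide_distrib)
  finally show ?thesis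
    using 0 assms(3) by (simp add: loss_def geometric_strategy_def)
next
  case (Suc n)
  have low: "of_int lam0 * \<rho> ^ n \<le> real_of_int h - 1"
    using geometric_strategy_less_khat Suc by simp
  \<comment> \<open>The logarithm can afford to drop the \<open>- 1\<close> of \<open>low\<close>;
    the geometric sum below keeps it.\<close>
  have "\<rho> ^ n \<le> of_int h / of_int lam0"
    using low assms(1) by (simp add: field_simps)
  then have "ln (\<rho> ^ n) \<le> ln (of_int h / of_int lam0)"
    using assms by (intro ln_mono) auto
  then have n: "real n \<le> ln (of_int h / of_int lam0) / ln \<rho>"
    using assms(2) by (simp add: ln_realpow field_simps)
  have "0 \<le> (\<rho> - 2)\<^sup>2" by simp
  then have "4 * (\<rho> - 1) \<le> \<rho>\<^sup>2" by (simp add: power2_eq_square algebra_simps)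
  then have four: "4 \<le> \<rho>\<^sup>2 / (\<rho> - 1)"
    using assms(2) by (simp add: pos_le_divide_eq)
  have "of_int lam0 * (\<rho> ^ Suc (Suc n) - 1) = \<rho>\<^sup>2 * (of_int lam0 * \<rho> ^ n) - of_int lam0"
    by (simp add: power2_eq_square algebra_simps)
  also have "\<dots> \<le> \<rho>\<^sup>2 * (of_int h - 1) - of_int lam0"
    using low by (intro diff_right_mono mult_left_mono) auto
  finally have "of_int lam0 * (\<rho> ^ Suc (Suc n) - 1) / (\<rho> - 1)
      \<le> (\<rho>\<^sup>2 * (of_int h - 1) - of_int lam0) / (\<rho> - 1)"
    using assms(2) by (intro divide_right_mono) auto
  also have "\<dots> = (\<rho> + 1 / (\<rho> - 1)) * of_int h + of_int h - \<rho>\<^sup>2 / (\<rho> - 1) - of_int lam0 / (\<rho> - 1)"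
  proof -
    \<comment> \<open>The sum itself grows like \<open>\<rho>\<^sup>2 / (\<rho> - 1)\<close> times
      \<open>h\<close>. Splitting off 1 from this factor isolates the \<open>h\<close> that the loss
      subtracts and leaves the asymptotic value.\<close>
    have "(\<rho> + 1 / (\<rho> - 1)) + 1 = \<rho>\<^sup>2 / (\<rho> - 1)"
      using assms(2) by (simp add: field_simps power2_eq_square)
    then have "(\<rho> + 1 / (\<rho> - 1)) * of_int h + of_int h = \<rho>\<^sup>2 / (\<rho> - 1) * of_int h"
      by (metis distrib_right mult_1)
    then show ?thesis by (simp add: diff_divide_distrib right_diff_distrib)
  qed
  \<comment> \<open>Of \<open>real (Suc n)\<close>, the part \<open>n\<close> is paid by the
    logarithm and the remaining 1 by the term
    \<open>- \<rho>\<^sup>2 / (\<rho> - 1)\<close>.\<close>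
  finally have "of_int lam0 * (\<rho> ^ Suc (Suc n) - 1) / (\<rho> - 1) + real (Suc n) - of_int h
      \<le> (\<rho> + 1 / (\<rho> - 1)) * of_int h - of_int lam0 / (\<rho> - 1)
        + ln (of_int h / of_int lam0) / ln \<rho>"
    using n four by simp
  moreover have "real_of_int (loss (geometric_strategy lam0 \<rho>) h)
      \<le> of_int lam0 * (\<rho> ^ Suc (Suc n) - 1) / (\<rho> - 1) + real (Suc n) - of_int h"
    using sum_geometric_strategy_le[of \<rho> lam0 "Suc n"] assms(2)
    unfolding loss_def Suc of_int_diff by linarith
  ultimately show ?thesis by linarith
qed

lemma rel_loss_upper_bound_geometric:
  fixes \<rho> :: real
  assumes "lam0 \<ge> 1" "\<rho> > 1"
  shows "rel_loss_upper_bound (geometric_strategy lam0 \<rho>) (geometric_upper lam0 \<rho>)"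
  unfolding rel_loss_upper_bound_def
proof (intro allI impI)
  fix h assume "geometric_strategy lam0 \<rho> 0 \<le> h"
  then have h: "lam0 \<le> h" by (simp add: geometric_strategy_def)
  have "rel_loss (geometric_strategy lam0 \<rho>) h
      \<le> ((\<rho> + 1 / (\<rho> - 1)) * of_int h - of_int lam0 / (\<rho> - 1)
        + ln (of_int h / of_int lam0) / ln \<rho>) / of_int h"
    unfolding rel_loss_def using loss_geometric_strategy_le[OF assms h] assms h
    by (intro divide_right_mono) auto
  also have "\<dots> = geometric_upper lam0 \<rho> h"
    using assms h by (simp add: geometric_upper_def add_divide_distrib diff_divide_distrib mult.commute)
  finally show "rel_loss (geometric_strategy lam0 \<rho>) h \<le> geometric_upper lam0 \<rho> h" .
qed

lemma tendsto_geometric_upper: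
  fixes \<rho> :: real
  assumes "lam0 \<ge> 1" "\<rho> > 1"
  shows "(geometric_upper lam0 \<rho> \<longlongrightarrow> \<rho> + 1 / (\<rho> - 1)) at_top"
proof -
  \<comment> \<open>With constants of known sign the limit can be computed over a real variable; it
    is then pulled back along the embedding of the integers.\<close>
  define c where "c = real_of_int lam0"
  define a where "a = \<rho> - 1"
  define l where "l = ln \<rho>"
  have "c > 0" "a > 0" "l > 0" using assms by (auto simp: c_def a_def l_def)
  then have "((\<lambda>x::real. \<rho> + 1 / a - c / (x * a) + ln (x / c) / (x * l)) \<longlongrightarrow> \<rho> + 1 / a) at_top"
    by real_asymp
  from filterlim_compose[OF this filterlim_real_of_int_at_top]
  show ?thesis unfolding geometric_upper_def c_def a_def l_def .
qed

text \<open>Uniqueness of limits gives the equivalence, which reduces optimality to minimising a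
  real function of \<rho>.\<close>

lemma asymptotic_upper_bound_geometric:
  fixes \<rho> :: real
  assumes "lam0 \<ge> 1" "\<rho> > 1"
  shows "asymptotic_upper_bound (geometric_strategy lam0 \<rho>) (geometric_upper lam0 \<rho>) L
    \<longleftrightarrow> L = \<rho> + 1 / (\<rho> - 1)"
  unfolding asymptotic_upper_bound_def
  using rel_loss_upper_bound_geometric[OF assms] tendsto_geometric_upper[OF assms]
    tendsto_unique[OF trivial_limit_at_top_linorder] by blast

lemma asymptotic_value_minus_3:
  fixes \<rho> :: real
  assumes "\<rho> > 1"
  shows "\<rho> + 1 / (\<rho> - 1) - 3 = (\<rho> - 2)\<^sup>2 / (\<rho> - 1)"
  using assms by (simp add: field_simps power2_eq_square)

lemma optimal_choice_geometric:
  assumes "lam0 \<ge> 1"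
  shows "optimal_choice {1<..} (geometric_strategy lam0) (geometric_upper lam0) r \<longleftrightarrow> r = 2"
proof -
  have ge3: "3 \<le> \<rho> + 1 / (\<rho> - 1)" if "\<rho> > 1" for \<rho> :: real
  proof -
    have "0 \<le> (\<rho> - 2)\<^sup>2 / (\<rho> - 1)" using that by simp
    then show ?thesis using asymptotic_value_minus_3[OF that] by linarith
  qed
  have opt: "optimal_choice {1<..} (geometric_strategy lam0) (geometric_upper lam0) r
      \<longleftrightarrow> r > 1 \<and> (\<forall>\<rho>>1. r + 1 / (r - 1) \<le> \<rho> + 1 / (\<rho> - 1))"
    using asymptotic_upper_bound_geometric[OF assms] by (auto simp: optimal_choice_def)
  show ?thesis
  proof
    assume "optimal_choice {1<..} (geometric_strategy lam0) (geometric_upper lam0) r"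
    then have r: "r > 1" and "\<forall>\<rho>>1. r + 1 / (r - 1) \<le> \<rho> + 1 / (\<rho> - 1)"
      using opt by auto
    \<comment> \<open>Comparison with the parameter 2, whose value is 3, forces the excess over 3 to
      vanish, and with it the square \<open>(r - 2)\<^sup>2\<close>.\<close>
    from this(2)[rule_format, of 2] have "r + 1 / (r - 1) \<le> 3" by simp
    then have "(r - 2)\<^sup>2 / (r - 1) = 0"
      using ge3[OF r] asymptotic_value_minus_3[OF r] by linarith
    then show "r = 2" using r by simp
  next
    assume "r = 2"
    then show "optimal_choice {1<..} (geometric_strategy lam0) (geometric_upper lam0) r"
      using opt ge3 by simp
  qed
qed

theorem theorem10:
  fixes lam0 :: int
  assumes "lam0 \<ge> 1"
  shows "asymptotically_optimal {1<..} (geometric_strategy lam0) (geometric_upper lam0)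
    \<and> (\<forall>r. optimal_choice {1<..} (geometric_strategy lam0) (geometric_upper lam0) r \<longleftrightarrow> r = 2)
    \<and> (\<forall>\<rho>>1. asymptotic_upper_bound (geometric_strategy lam0 \<rho>) (geometric_upper lam0 \<rho>)
                (\<rho> + 1 / (\<rho> - 1)))
    \<and> asymptotic_upper_bound (geometric_strategy lam0 2) (geometric_upper lam0 2) 3"
  using asymptotic_upper_bound_geometric[OF assms] optimal_choice_geometric[OF assms]
  by (auto simp: asymptotically_optimal_def bounded_strategy_def)

end
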